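(* For every ordered tree $T$ with $n\ge1$ edges, $w_{12}(T)$ equals the number of Klazar trees whose underlying (unlabeled) ordered tree is $T$. Consequently $w_{12}(n)$ equals the number of Klazar trees with $n$ edges.
   Context: Ordered trees are rooted plane trees. A drawing of an $n$-edge ordered tree $T$ is a sequence $(T_1,T_2,\dots,T_n)$ of (unlabeled) ordered trees such that $T_n=T$, $T_i$ has $i$ edges, and $T_{i-1}$ arises from $T_i$ by deleting a leaf of $T_i$ (a non-root vertex with no children). $w_{12}(T)$ is the number of different drawings of $T$, and $w_{12}(n)=\sum_T w_{12}(T)$ over all $n$-edge ordered trees $T$. An $n$-edge increasing ordered tree is an ordered tree with vertices labeled bijectively by $0,1,\dots,n$ so that each child's label exceeds its parent's; vertices are identified with labels. A vertex $v$ is a descent terminator if it has a sibling immediately to its left that is larger than $v$. The big cohort of $v$ is the maximal terminal (rightmost) sublist of the left-to-right list of siblings strictly to the left of $v$ all of whose entries exceed $v$; the associate of a descent terminator $v$ is the smallest entry of its big cohort. A Klazar violator is a descent terminator $v$ whose associate is smaller than every child of $v$ (vacuously true for a leaf). A Klazar tree is an increasing ordered tree with no Klazar violators. *)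

theory Defs
  imports Main
begin

text \<open>
  Unlabeled ordered trees are trees of type \<open>unit otree\<close>; labeled ones have type \<open>nat otree\<close>.
  The list of children is read from left to right.
\<close>

datatype 'a otree = Node (root: 'a) (children: "'a otree list")

fun edges :: "'a otree \<Rightarrow> nat" where
  "edges (Node a ts) = (\<Sum>t\<leftarrow>ts. Suc (edges t))"

fun labels :: "'a otree \<Rightarrow> 'a list" where
  "labels (Node a ts) = a # concat (map labels ts)"

fun subtrees :: "'a otree \<Rightarrow> 'a otree set" where
  "subtrees (Node a ts) = insert (Node a ts) (\<Union>t\<in>set ts. subtrees t)"

definition underlying :: "nat otree \<Rightarrow> unit otree" where
  "underlying = map_otree (\<lambda>_. ())"


inductive delete_leaf :: "'a otree \<Rightarrow> 'a otree \<Rightarrow> bool" where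
  here: "delete_leaf (Node a (xs @ Node b [] # ys)) (Node a (xs @ ys))"
| below: "delete_leaf t t' \<Longrightarrow> delete_leaf (Node a (xs @ t # ys)) (Node a (xs @ t' # ys))"

text \<open>The drawing \<open>(T\<^sub>1, \<dots>, T\<^sub>n)\<close> is a list \<open>ts\<close> with \<open>T\<^sub>i = ts ! (i - 1)\<close>.\<close>

definition drawings :: "unit otree \<Rightarrow> unit otree list set" where
  "drawings T = {ts. length ts = edges T \<and> ts \<noteq> [] \<and> last ts = T \<and>
     (\<forall>i\<in>{1..edges T}. edges (ts ! (i - 1)) = i) \<and>
     (\<forall>i\<in>{2..edges T}. delete_leaf (ts ! (i - 1)) (ts ! (i - 2)))}"

definition w12 :: "unit otree \<Rightarrow> nat" where
  "w12 T = card (drawings T)"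

definition w12_total :: "nat \<Rightarrow> nat" where
  "w12_total n = (\<Sum>T | edges T = n. w12 T)"


fun increasing :: "nat otree \<Rightarrow> bool" where
  "increasing (Node a ts) \<longleftrightarrow> (\<forall>t\<in>set ts. a < root t \<and> increasing t)"

definition increasing_otree :: "nat otree \<Rightarrow> bool" where
  "increasing_otree t \<longleftrightarrow>
     distinct (labels t) \<and> set (labels t) = {0..edges t} \<and> increasing t"

text \<open>
  In the next three definitions \<open>ls\<close> is the left-to-right list of the siblings strictly to the
  left of \<open>v\<close>.
\<close>

definition descent_terminator :: "nat list \<Rightarrow> nat \<Rightarrow> bool" where
  "descent_terminator ls v \<longleftrightarrow> ls \<noteq> [] \<and> v < last ls"

definition big_cohort :: "nat list \<Rightarrow> nat \<Rightarrow> nat list" where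
  "big_cohort ls v = rev (takeWhile (\<lambda>u. v < u) (rev ls))"

definition associate :: "nat list \<Rightarrow> nat \<Rightarrow> nat" where
  "associate ls v = Min (set (big_cohort ls v))"

definition klazar_violator :: "nat otree \<Rightarrow> nat \<Rightarrow> bool" where
  "klazar_violator t v \<longleftrightarrow>
     (\<exists>p xs cs ys. Node p (xs @ Node v cs # ys) \<in> subtrees t \<and>
        descent_terminator (map root xs) v \<and>
        (\<forall>c\<in>set cs. associate (map root xs) v < root c))"

definition klazar_tree :: "nat otree \<Rightarrow> bool" where
  "klazar_tree t \<longleftrightarrow> increasing_otree t \<and> (\<nexists>v. klazar_violator t v)"


text \<open>All sets whose cardinality is taken, and the index set of \<^const>\<open>w12_total\<close>, are finite.\<close>

lemma finite_otrees_edges_le: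
  assumes "finite A"
  shows "finite {t. set (labels t) \<subseteq> A \<and> edges t \<le> n}"
proof (induction n)
  case 0
  have "{t. set (labels t) \<subseteq> A \<and> edges t \<le> 0} \<subseteq> (\<lambda>a. Node a []) ` A"
  proof
    fix t assume "t \<in> {t. set (labels t) \<subseteq> A \<and> edges t \<le> 0}"
    then show "t \<in> (\<lambda>a. Node a []) ` A"
    proof (cases t)
      case (Node a ts)
      with \<open>t \<in> _\<close> show ?thesis by (cases ts) auto
    qed
  qed
  then show ?case using assms finite_subset by blast
next
  case (Suc n)
  let ?S = "{t. set (labels t) \<subseteq> A \<and> edges t \<le> n}"
  have "{t. set (labels t) \<subseteq> A \<and> edges t \<le> Suc n}
    \<subseteq> (\<lambda>(a, ts). Node a ts) ` (A \<times> {ts. set ts \<subseteq> ?S \<and> length ts \<le> Suc n})"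
  proof
    fix t assume t: "t \<in> {t. set (labels t) \<subseteq> A \<and> edges t \<le> Suc n}"
    obtain a ts where N: "t = Node a ts" by (cases t)
    have sum: "(\<Sum>s\<leftarrow>ts. Suc (edges s)) \<le> Suc n" using t N by simp
    have "edges s \<le> n" if "s \<in> set ts" for s
      using member_le_sum_list[of "Suc (edges s)" "map (\<lambda>s. Suc (edges s)) ts"] that sum by auto
    moreover have "length ts \<le> (\<Sum>s\<leftarrow>ts. Suc (edges s))" by (induction ts) auto
    ultimately show "t \<in> (\<lambda>(a, ts). Node a ts) ` (A \<times> {ts. set ts \<subseteq> ?S \<and> length ts \<le> Suc n})"
      using t N sum by (auto simp: image_iff)
  qed
  moreover have "finite (A \<times> {ts. set ts \<subseteq> ?S \<and> length ts \<le> Suc n})"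
    using assms Suc finite_lists_length_le by blast
  ultimately show ?case using finite_subset by blast
qed

lemma finite_unlabeled_otrees: "finite {T :: unit otree. edges T = n}"
  by (rule finite_subset[OF _ finite_otrees_edges_le[of UNIV n]]) auto

lemma finite_klazar_trees: "finite {K. klazar_tree K \<and> edges K = n}"
  by (rule finite_subset[OF _ finite_otrees_edges_le[of "{0..n}" n]])
    (auto simp: klazar_tree_def increasing_otree_def)

lemma edges_underlying [simp]: "edges (underlying t) = edges t"
  unfolding underlying_def
proof (induction t)
  case (Node a ts)
  then have *: "map ((\<lambda>s. Suc (edges s)) \<circ> map_otree (\<lambda>_. ())) ts = map (\<lambda>s. Suc (edges s)) ts"
    by simp
  show ?case by (simp add: * del: map_eq_conv)
qed

lemma finite_klazar_trees_underlying: "finite {K. klazar_tree K \<and> underlying K = T}"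
  by (rule finite_subset[OF _ finite_klazar_trees[of "edges T"]]) auto

lemma finite_drawings: "finite (drawings T)"
proof (rule finite_subset)
  show "drawings T \<subseteq> {ts. set ts \<subseteq> {t. set (labels t) \<subseteq> UNIV \<and> edges t \<le> edges T} \<and>
      length ts = edges T}"
  proof
    fix ts assume ts: "ts \<in> drawings T"
    have "edges (ts ! i) \<le> edges T" if "i < edges T" for i
    proof -
      have "Suc i \<in> {1..edges T}" using that by simp
      then have "edges (ts ! (Suc i - 1)) = Suc i" using ts unfolding drawings_def by blast
      then show ?thesis using that by simp
    qed
    then show "ts \<in> {ts. set ts \<subseteq> {t. set (labels t) \<subseteq> UNIV \<and> edges t \<le> edges T} \<and>
        length ts = edges T}"
      using ts by (auto simp: drawings_def in_set_conv_nth)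
  qed
  show "finite {ts. set ts \<subseteq> {t :: unit otree. set (labels t) \<subseteq> UNIV \<and> edges t \<le> edges T} \<and>
      length ts = edges T}"
    using finite_lists_length_eq[OF finite_otrees_edges_le[of "UNIV :: unit set" "edges T"]]
    by simp
qed

end

theory Submission
  imports Defs "HOL-Library.Multiset"
begin

text \<open>
  Both counts obey the recursion that sums over the distinct trees \<open>T'\<close> arising from \<open>T\<close> by deleting
  a leaf. For drawings this is immediate: the last tree is \<open>T\<close>, and the rest is a drawing of such
  a \<open>T'\<close> (\<open>w12_rec\<close>).

  For Klazar trees, delete the vertex with the largest label \<open>n\<close>, which is a leaf. The point is that
  the absence of violators says the following about \<open>n\<close> and nothing else
  (\<open>no_violator_strip_iff\<close>): the remaining tree has no violators, and the right neighbour of \<open>n\<close>, if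
  there is one, is not a leaf. Indeed, \<open>n\<close> is too large to lower a minimum over a cohort or to be the
  child that saves a vertex from being a violator. So it matters only to its right neighbour, which
  it makes a descent terminator; if the cohort of this neighbour is \<open>n\<close> alone, the associate is \<open>n\<close>,
  and any child at all prevents a violation.

  Two deletions of leaves of \<open>T\<close> that belong to the same run of consecutive leaf siblings give the
  same tree. The vertex \<open>n\<close> of a Klazar tree sits at the end of its run, so each \<open>T'\<close>
  corresponds to exactly one place for \<open>n\<close>: it exists because an inserted
  leaf can be slid to the end of its run (\<open>insert_max_label\<close>), and it is unique because the shape
  before and after the deletion determines the run (\<open>strip_inj\<close>). Hence deleting \<open>n\<close> is a bijection
  from the Klazar trees of shape \<open>T\<close> to the Klazar trees whose shape is one of the \<open>T'\<close>
  (\<open>bij_betw_strip_klazar\<close>).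
\<close>

section \<open>Trees, labels and leaf deletion\<close>

lemma underlying_Node [simp]: "underlying (Node a ts) = Node () (map underlying ts)"
  by (simp add: underlying_def)

lemma root_in_labels [simp]: "root t \<in> set (labels t)"
  by (cases t) simp

lemma children_empty_iff_underlying: "children t = [] \<longleftrightarrow> underlying t = Node () []"
  by (cases t) simp

lemma delete_leaf_map: "delete_leaf t t' \<Longrightarrow> delete_leaf (map_otree f t) (map_otree f t')"
  by (induction rule: delete_leaf.induct) (auto intro: delete_leaf.intros)

lemma edges_delete_leaf: "delete_leaf t t' \<Longrightarrow> edges t = Suc (edges t')"
  by (induction rule: delete_leaf.induct) auto

lemma finite_delete_leaf: "finite {T'. delete_leaf (T :: unit otree) T'}"
  by (rule finite_subset[OF _ finite_unlabeled_otrees[of "edges T - 1"]])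
    (auto dest: edges_delete_leaf)


section \<open>Removing the largest label\<close>

text \<open>
  Dropping every proper subtree rooted at \<open>m\<close> deletes the vertex \<open>m\<close> when \<open>m\<close> is the largest label of
  an increasing tree, since then it labels a leaf.
\<close>

fun strip :: "nat \<Rightarrow> nat otree \<Rightarrow> nat otree" where
  "strip m (Node a ts) = Node a (map (strip m) (filter (\<lambda>t. root t \<noteq> m) ts))"

lemma root_strip [simp]: "root (strip m t) = root t"
  by (cases t) simp

lemma strip_id: "m \<notin> set (labels t) \<Longrightarrow> strip m t = t"
proof (induction t)
  case (Node a ts)
  then have "filter (\<lambda>t. root t \<noteq> m) ts = ts"
    by (intro filter_True) (use root_in_labels in fastforce)
  with Node show ?case by (auto intro!: map_idI)
qed

lemma increasing_strip: "increasing t \<Longrightarrow> increasing (strip m t)"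
  by (induction t) auto

text \<open>
  The label \<open>m\<close> may but need not occur, so that all subtrees at the children of such a tree that
  are not rooted at \<open>m\<close> have the same property; this is what inductions over the tree use.
\<close>

definition topped :: "nat \<Rightarrow> nat otree \<Rightarrow> bool" where
  "topped m t \<longleftrightarrow> distinct (labels t) \<and> increasing t \<and> (\<forall>x\<in>set (labels t). x \<le> m) \<and> root t \<noteq> m"

lemma topped_root_less: "topped m t \<Longrightarrow> root t < m"
  using root_in_labels[of t] unfolding topped_def by (meson le_neq_implies_less)

lemma topped_child:
  assumes "topped m (Node a ts)" "t \<in> set ts" "root t \<noteq> m"
  shows "topped m t"
proof -
  have "distinct (labels t)" using assms(1,2) by (auto simp: topped_def in_set_conv_decomp)
  then show ?thesis using assms by (auto simp: topped_def)
qed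

lemma topped_cases [consumes 1, case_names here below]:
  assumes top: "topped m (Node a ts)"
  obtains xs ys where "ts = xs @ Node m [] # ys"
      and "\<And>t. t \<in> set xs \<union> set ys \<Longrightarrow> m \<notin> set (labels t) \<and> topped m t"
    | "\<And>t. t \<in> set ts \<Longrightarrow> topped m t"
proof (cases "\<exists>t\<in>set ts. root t = m")
  case True
  then obtain xs t ys where ts: "ts = xs @ t # ys" "root t = m" by (auto simp: in_set_conv_decomp)
  obtain cs where t: "t = Node m cs" using ts by (cases t) auto
  have "cs = []"
  proof (cases cs)
    case (Cons c cs')
    then have "m < root c" "root c \<le> m"
      using top root_in_labels[of c] unfolding topped_def ts t by auto
    then show ?thesis by simp
  qed simp
  moreover have "m \<notin> set (labels s) \<and> topped m s" if "s \<in> set xs \<union> set ys" for s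
  proof -
    have "m \<notin> set (labels s)" using that top unfolding topped_def ts t by auto
    moreover from this have "root s \<noteq> m" using root_in_labels[of s] by metis
    ultimately show ?thesis using topped_child[OF top] that ts by auto
  qed
  ultimately show ?thesis using that(1) ts t by blast
next
  case False
  then have "topped m t" if "t \<in> set ts" for t using topped_child[OF top that] that by blast
  then show ?thesis using that(2) by blast
qed

lemma strip_here:
  assumes "\<And>t. t \<in> set xs \<union> set ys \<Longrightarrow> m \<notin> set (labels t)"
  shows "strip m (Node a (xs @ Node m [] # ys)) = Node a (xs @ ys)"
proof -
  have "filter (\<lambda>t. root t \<noteq> m) zs = zs \<and> map (strip m) zs = zs"
    if "set zs \<subseteq> set xs \<union> set ys" for zs
    using that assms by (auto intro!: filter_True map_idI strip_id) (metis root_in_labels subsetD Un_iff)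
  from this[of xs] this[of ys] show ?thesis by simp
qed

lemma strip_below:
  assumes "\<And>t. t \<in> set ts \<Longrightarrow> topped m t"
  shows "strip m (Node a ts) = Node a (map (strip m) ts)"
proof -
  have "filter (\<lambda>t. root t \<noteq> m) ts = ts"
    using assms by (auto intro!: filter_True simp: topped_def)
  then show ?thesis by simp
qed

lemma labels_strip: "topped m t \<Longrightarrow> labels (strip m t) = filter (\<lambda>x. x \<noteq> m) (labels t)"
proof (induction t)
  case (Node a ts)
  have a: "a \<noteq> m" using Node.prems by (simp add: topped_def)
  from Node.prems show ?case
  proof (cases rule: topped_cases)
    case (here xs ys)
    have "filter (\<lambda>x. x \<noteq> m) (concat (map labels zs)) = concat (map labels zs)"
      if "set zs \<subseteq> set xs \<union> set ys" for zs
      using that here(2) by (fastforce intro!: filter_True)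
    moreover have "strip m (Node a (xs @ Node m [] # ys)) = Node a (xs @ ys)"
      using here(2) by (intro strip_here) blast
    ultimately show ?thesis unfolding here(1) using a by simp
  next
    case below
    then have "concat (map labels (map (strip m) ts)) = concat (map (\<lambda>t. filter (\<lambda>x. x \<noteq> m) (labels t)) ts)"
      using Node.IH by (auto intro!: arg_cong[where f = concat])
    then show ?thesis using a strip_below[OF below, where a = a] by (simp add: filter_concat comp_def)
  qed
qed

lemma delete_leaf_strip: "topped m t \<Longrightarrow> m \<in> set (labels t) \<Longrightarrow> delete_leaf t (strip m t)"
proof (induction t)
  case (Node a ts)
  have a: "a \<noteq> m" using Node.prems by (simp add: topped_def)
  from Node.prems(1) show ?case
  proof (cases rule: topped_cases)
    case (here xs ys)
    have "strip m (Node a (xs @ Node m [] # ys)) = Node a (xs @ ys)"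
      using here(2) by (intro strip_here) blast
    then show ?thesis unfolding here(1) by (simp only: delete_leaf.here)
  next
    case below
    obtain t where "t \<in> set ts" "m \<in> set (labels t)" using Node.prems a by auto
    then obtain xs ys where ts: "ts = xs @ t # ys" by (auto simp: in_set_conv_decomp)
    have "m \<notin> set (labels s)" if "s \<in> set xs \<union> set ys" for s
      using that Node.prems(1) \<open>m \<in> set (labels t)\<close> unfolding topped_def ts by auto
    then have "map (strip m) xs = xs" "map (strip m) ys = ys" by (auto intro!: map_idI strip_id)
    moreover have "strip m (Node a ts) = Node a (map (strip m) ts)"
      using below by (rule strip_below)
    ultimately have "strip m (Node a ts) = Node a (xs @ strip m t # ys)" by (simp add: ts)
    moreover have "delete_leaf t (strip m t)"
      using Node.IH below \<open>t \<in> set ts\<close> \<open>m \<in> set (labels t)\<close> by blast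
    ultimately show ?thesis using ts by (simp only: delete_leaf.below)
  qed
qed


section \<open>Klazar violators\<close>

definition admissible :: "nat list \<Rightarrow> nat otree \<Rightarrow> bool" where
  "admissible ls t \<longleftrightarrow> (descent_terminator ls (root t) \<longrightarrow>
     (\<exists>c\<in>set (children t). root c \<le> associate ls (root t)))"

text \<open>
  The accumulator \<open>ls\<close> holds the roots of the siblings already passed, which are what cohorts are
  made of. It lets a list of siblings be cut in two where a new vertex is inserted.
\<close>

fun admissible_siblings :: "nat list \<Rightarrow> nat otree list \<Rightarrow> bool" where
  "admissible_siblings ls [] \<longleftrightarrow> True"
| "admissible_siblings ls (t # ts) \<longleftrightarrow> admissible ls t \<and> admissible_siblings (ls @ [root t]) ts"

fun no_violator :: "nat otree \<Rightarrow> bool" where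
  "no_violator (Node a ts) \<longleftrightarrow> admissible_siblings [] ts \<and> (\<forall>t\<in>set ts. no_violator t)"

lemma admissible_siblings_append:
  "admissible_siblings ls (xs @ ys) \<longleftrightarrow>
     admissible_siblings ls xs \<and> admissible_siblings (ls @ map root xs) ys"
  by (induction xs arbitrary: ls) auto

lemma admissible_siblings_iff:
  "admissible_siblings ls ts \<longleftrightarrow>
     (\<forall>xs t ys. ts = xs @ t # ys \<longrightarrow> admissible (ls @ map root xs) t)"
proof (induction ts arbitrary: ls)
  case (Cons s ts)
  show ?case
  proof
    assume "admissible_siblings ls (s # ts)"
    then show "\<forall>xs t ys. s # ts = xs @ t # ys \<longrightarrow> admissible (ls @ map root xs) t"
      by (metis admissible_siblings.simps(2) admissible_siblings_append)
  next
    assume *: "\<forall>xs t ys. s # ts = xs @ t # ys \<longrightarrow> admissible (ls @ map root xs) t"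
    have "admissible ls s" using *[rule_format, of "[]"] by simp
    moreover have "admissible ((ls @ [root s]) @ map root xs) t" if "ts = xs @ t # ys" for xs t ys
      using *[rule_format, of "s # xs" t ys] that by simp
    ultimately show "admissible_siblings ls (s # ts)"
      unfolding admissible_siblings.simps Cons.IH by blast
  qed
qed simp

lemma no_violator_iff_subtrees:
  "no_violator t \<longleftrightarrow> (\<forall>p ts. Node p ts \<in> subtrees t \<longrightarrow> admissible_siblings [] ts)"
  by (induction t) auto

lemma klazar_tree_iff: "klazar_tree t \<longleftrightarrow> increasing_otree t \<and> no_violator t"
proof -
  have "(\<nexists>v. klazar_violator t v) \<longleftrightarrow>
    (\<forall>p xs v cs ys. Node p (xs @ Node v cs # ys) \<in> subtrees t \<longrightarrow>
       admissible (map root xs) (Node v cs))"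
    unfolding klazar_violator_def admissible_def otree.sel not_less[symmetric] by blast
  also have "\<dots> \<longleftrightarrow> (\<forall>p ts. Node p ts \<in> subtrees t \<longrightarrow> admissible_siblings [] ts)"
    unfolding admissible_siblings_iff append_Nil by (metis otree.exhaust)
  finally show ?thesis unfolding no_violator_iff_subtrees klazar_tree_def by blast
qed

lemma descent_terminator_insert:
  "v < m \<Longrightarrow> descent_terminator (as @ m # bs) v \<longleftrightarrow> bs = [] \<or> descent_terminator (as @ bs) v"
  by (auto simp: descent_terminator_def)

lemma associate_in:
  assumes "descent_terminator ls v"
  shows "associate ls v \<in> set ls"
proof -
  have "big_cohort ls v \<noteq> []"
    using assms by (cases ls rule: rev_cases) (auto simp: descent_terminator_def big_cohort_def)
  then have "associate ls v \<in> set (big_cohort ls v)"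
    unfolding associate_def by (intro Min_in) auto
  then show ?thesis by (auto simp: big_cohort_def dest: set_takeWhileD)
qed

text \<open>
  If the cohort reaches up to the place of \<open>m\<close>, it gains \<open>m\<close> next to an entry that is at most \<open>m\<close>,
  which keeps the minimum; otherwise it stays the same.
\<close>

lemma associate_insert:
  assumes "descent_terminator (as @ bs) v" "v < m" "\<forall>x\<in>set (as @ bs). x \<le> m"
  shows "associate (as @ m # bs) v = associate (as @ bs) v"
proof (cases "\<forall>x\<in>set bs. v < x")
  case True
  let ?B = "set (big_cohort (as @ bs) v)"
  have "set (big_cohort (as @ m # bs) v) = insert m ?B"
    using True assms(2) by (auto simp: big_cohort_def takeWhile_append)
  moreover have "?B \<noteq> {}"
    using assms(1) by (cases "as @ bs" rule: rev_cases) (auto simp: descent_terminator_def big_cohort_def)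
  moreover have "\<forall>x\<in>?B. x \<le> m"
    using assms(3) by (auto simp: big_cohort_def dest!: set_takeWhileD)
  ultimately show ?thesis
    unfolding associate_def by (simp add: Min_insert min_absorb2)
next
  case False
  then show ?thesis
    by (auto simp: associate_def big_cohort_def takeWhile_append)
qed

lemma associate_snoc:
  assumes "\<not> descent_terminator as v" "v < m"
  shows "associate (as @ [m]) v = m"
  using assms by (cases as rule: rev_cases)
    (auto simp: associate_def big_cohort_def descent_terminator_def)

text \<open>
  A new large entry \<open>m\<close> far to the left of \<open>t\<close> is harmless. Immediately to the left of \<open>t\<close>, either
  \<open>t\<close> was a descent terminator before and keeps its associate (and if it is admissible it has a
  child), or its associate becomes \<open>m\<close>, which every child of \<open>t\<close> undercuts.
\<close>

lemma admissible_insert: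
  assumes "root t < m" "\<forall>x\<in>set (as @ bs). x \<le> m" "\<forall>c\<in>set (children t). root c \<le> m"
  shows "admissible (as @ m # bs) t \<longleftrightarrow> admissible (as @ bs) t \<and> (bs = [] \<longrightarrow> children t \<noteq> [])"
proof (cases "descent_terminator (as @ bs) (root t)")
  case True
  then show ?thesis
    using assms associate_insert[OF True assms(1,2)]
    by (auto simp: admissible_def descent_terminator_insert)
next
  case False
  show ?thesis
  proof (cases "bs = []")
    case True
    then show ?thesis using False assms associate_snoc[of as "root t" m]
      by (cases "children t") (auto simp: admissible_def descent_terminator_insert)
  next
    case bs: False
    then show ?thesis using False assms by (auto simp: admissible_def descent_terminator_insert)
  qed
qed

lemma admissible_siblings_insert:
  assumes "\<forall>t\<in>set ts. root t < m \<and> (\<forall>c\<in>set (children t). root c \<le> m)"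
    "\<forall>x\<in>set (as @ bs). x \<le> m"
  shows "admissible_siblings (as @ m # bs) ts \<longleftrightarrow>
     admissible_siblings (as @ bs) ts \<and> (bs = [] \<and> ts \<noteq> [] \<longrightarrow> children (hd ts) \<noteq> [])"
  using assms
proof (induction ts arbitrary: bs)
  case (Cons t ts)
  have "admissible_siblings (as @ m # bs @ [root t]) ts \<longleftrightarrow> admissible_siblings (as @ bs @ [root t]) ts"
    using Cons.IH[of "bs @ [root t]"] Cons.prems by auto
  then show ?case using admissible_insert[of t m as bs] Cons.prems by auto
qed simp

text \<open>
  A child with label \<open>m\<close> exceeds every associate taken from \<open>ls\<close>, hence never rescues its parent.
\<close>

lemma admissible_strip:
  assumes "root t \<noteq> m" "\<forall>x\<in>set ls. x < m"
  shows "admissible ls (strip m t) \<longleftrightarrow> admissible ls t"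
proof (cases "descent_terminator ls (root t)")
  case True
  then have "associate ls (root t) < m" using associate_in assms by blast
  then show ?thesis by (cases t) (auto simp: admissible_def)
qed (simp add: admissible_def)

lemma admissible_siblings_strip:
  assumes "\<forall>t\<in>set ts. root t < m" "\<forall>x\<in>set ls. x < m"
  shows "admissible_siblings ls (map (strip m) ts) \<longleftrightarrow> admissible_siblings ls ts"
  using assms by (induction ts arbitrary: ls) (auto simp: admissible_strip)


section \<open>The place of the largest label in a Klazar tree\<close>

fun ends_leaf_run :: "nat \<Rightarrow> nat otree \<Rightarrow> bool" where
  "ends_leaf_run m (Node a ts) \<longleftrightarrow>
     (\<forall>xs x y ys. ts = xs @ x # y # ys \<longrightarrow> root x = m \<longrightarrow> children y \<noteq> []) \<and>
     (\<forall>t\<in>set ts. ends_leaf_run m t)"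

lemma ends_leaf_run_trivial: "m \<notin> set (labels t) \<Longrightarrow> ends_leaf_run m t"
proof (induction t)
  case (Node a ts)
  then have "root t \<noteq> m" if "t \<in> set ts" for t using that root_in_labels[of t] by auto
  with Node show ?case by auto
qed

lemma ends_leaf_run_here:
  assumes "\<And>t. t \<in> set xs \<union> set ys \<Longrightarrow> m \<notin> set (labels t)"
  shows "ends_leaf_run m (Node a (xs @ Node m [] # ys)) \<longleftrightarrow> (ys \<noteq> [] \<longrightarrow> children (hd ys) \<noteq> [])"
    (is "?L \<longleftrightarrow> ?R")
proof
  assume ?L
  then have "\<forall>us x y vs. xs @ Node m [] # ys = us @ x # y # vs \<longrightarrow> root x = m \<longrightarrow> children y \<noteq> []"
    by simp
  from this[rule_format, of xs "Node m []" "hd ys" "tl ys"] show ?R by simp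
next
  assume R: ?R
  have r: "root t \<noteq> m" if "t \<in> set xs \<union> set ys" for t
    using assms[OF that] root_in_labels[of t] by metis
  have "children y \<noteq> []" if "xs @ Node m [] # ys = us @ x # y # vs" "root x = m" for us x y vs
  proof -
    have "x \<notin> set xs" "x \<notin> set ys" using r that(2) by auto
    then have "us = xs \<and> x = Node m [] \<and> y # vs = ys"
      using that r by (auto simp: append_eq_append_conv2 append_eq_Cons_conv Cons_eq_append_conv)
    then show ?thesis using R by auto
  qed
  moreover have "ends_leaf_run m t" if "t \<in> set xs \<union> set ys" for t
    using assms[OF that] by (rule ends_leaf_run_trivial)
  ultimately show ?L by auto
qed

lemma ends_leaf_run_below:
  assumes "\<And>t. t \<in> set ts \<Longrightarrow> topped m t"
  shows "ends_leaf_run m (Node a ts) \<longleftrightarrow> (\<forall>t\<in>set ts. ends_leaf_run m t)"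
  using assms by (auto simp: topped_def)

text \<open>
  If \<open>m\<close> is among the children of the root, its siblings are governed by \<open>admissible_siblings_insert\<close>,
  and \<open>m\<close> itself is admissible because nothing to its left is larger. If it lies deeper or is
  absent, the roots of the siblings do not change, and only \<open>admissible_siblings_strip\<close> is needed.
\<close>

lemma no_violator_strip_iff:
  "topped m t \<Longrightarrow> no_violator t \<longleftrightarrow> no_violator (strip m t) \<and> ends_leaf_run m t"
proof (induction t)
  case (Node a ts)
  from Node.prems show ?case
  proof (cases rule: topped_cases)
    case (here xs ys)
    have less: "root t < m" if "t \<in> set xs \<union> set ys" for t
      using here(2) that topped_root_less by blast
    have child: "\<forall>c\<in>set (children t). root c \<le> m" if "t \<in> set ys" for t
    proof -
      have "\<forall>x\<in>set (labels t). x \<le> m" using here(2) that by (auto simp: topped_def)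
      then show ?thesis by (cases t) (use root_in_labels in auto)
    qed
    have "admissible (map root xs) (Node m [])"
      using less last_in_set[of xs] by (fastforce simp: admissible_def descent_terminator_def last_map)
    then have "admissible_siblings [] (xs @ Node m [] # ys) \<longleftrightarrow>
        admissible_siblings [] (xs @ ys) \<and> (ys \<noteq> [] \<longrightarrow> children (hd ys) \<noteq> [])"
      using admissible_siblings_insert[of ys m "map root xs" "[]"] less child
      by (auto simp: admissible_siblings_append less_imp_le)
    moreover have "ends_leaf_run m (Node a (xs @ Node m [] # ys)) \<longleftrightarrow> (ys \<noteq> [] \<longrightarrow> children (hd ys) \<noteq> [])"
      using here(2) by (intro ends_leaf_run_here) blast
    moreover have "strip m (Node a (xs @ Node m [] # ys)) = Node a (xs @ ys)"
      using here(2) by (intro strip_here) blast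
    ultimately show ?thesis unfolding here(1) by auto
  next
    case below
    have "admissible_siblings [] (map (strip m) ts) \<longleftrightarrow> admissible_siblings [] ts"
      using below topped_root_less by (intro admissible_siblings_strip) auto
    moreover have "(\<forall>t\<in>set ts. no_violator t) \<longleftrightarrow>
        (\<forall>t\<in>set (map (strip m) ts). no_violator t) \<and> (\<forall>t\<in>set ts. ends_leaf_run m t)"
      using Node.IH below by auto
    moreover have "strip m (Node a ts) = Node a (map (strip m) ts)"
      using below by (rule strip_below)
    moreover have "ends_leaf_run m (Node a ts) \<longleftrightarrow> (\<forall>t\<in>set ts. ends_leaf_run m t)"
      using below by (rule ends_leaf_run_below)
    ultimately show ?thesis by simp
  qed
qed

text \<open>
  Suppose that the leaf \<open>m\<close> goes into a list at an early or at a later place, with a nonempty segment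
  \<open>zs\<close> in between. If the shapes of the two results agree, then comparing them at the early place
  shows that the first tree of \<open>zs\<close> is a leaf, so \<open>m\<close> at the early place does not end its run.
\<close>

lemma same_hole_if_ends_leaf_run:
  assumes "xs @ ys = us @ vs" "length xs \<le> length us"
    and "map underlying (xs @ Node m [] # ys) = map underlying (us @ Node m [] # vs)"
    and "ys \<noteq> [] \<longrightarrow> children (hd ys) \<noteq> []"
  shows "xs = us \<and> ys = vs"
proof -
  obtain zs where zs: "us = xs @ zs" "ys = zs @ vs"
    using assms(1,2) by (auto simp: append_eq_append_conv2)
  show ?thesis
  proof (cases zs)
    case (Cons z zs')
    then have "underlying z = Node () []" using assms(3) zs by simp
    then show ?thesis using assms(4) zs Cons by (simp add: children_empty_iff_underlying)
  qed (use zs in simp)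
qed

lemma strip_inj:
  assumes "topped m s" "topped m t" "ends_leaf_run m s" "ends_leaf_run m t"
    "underlying s = underlying t" "strip m s = strip m t"
  shows "s = t"
  using assms
proof (induction s arbitrary: t)
  case (Node a ss)
  obtain b ts where t: "t = Node b ts" by (cases t)
  have len: "length ss = length ts" using Node.prems(5) t by (auto dest: map_eq_imp_length_eq)
  have ab: "a = b" using Node.prems(6) t by simp
  from Node.prems(1) show ?case
  proof (cases rule: topped_cases)
    case s: (here xs ys)
    from Node.prems(2)[unfolded t] show ?thesis
    proof (cases rule: topped_cases)
      case t': (here us vs)
      have "xs @ ys = us @ vs"
        using Node.prems(6) strip_here[of xs ys m a] strip_here[of us vs m b] s t' unfolding t by auto
      moreover have "ys \<noteq> [] \<longrightarrow> children (hd ys) \<noteq> []"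
        using Node.prems(3) ends_leaf_run_here[of xs ys m a] s by auto
      moreover have "vs \<noteq> [] \<longrightarrow> children (hd vs) \<noteq> []"
        using Node.prems(4) ends_leaf_run_here[of us vs m b] t' unfolding t by auto
      moreover have "map underlying (xs @ Node m [] # ys) = map underlying (us @ Node m [] # vs)"
        using Node.prems(5) unfolding t s(1) t'(1) by simp
      ultimately have "xs = us \<and> ys = vs"
        using same_hole_if_ends_leaf_run[of xs ys us vs m] same_hole_if_ends_leaf_run[of us vs xs ys m]
        by (metis nat_le_linear)
      then show ?thesis using s t' t ab by simp
    next
      case below
      have "length (xs @ ys) = length ts"
        using Node.prems(6) strip_here[of xs ys m a] strip_below[OF below, where a = b] s unfolding t
        by (auto dest!: arg_cong[where f = length])
      then show ?thesis using len s by simp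
    qed
  next
    case s: below
    from Node.prems(2)[unfolded t] show ?thesis
    proof (cases rule: topped_cases)
      case (here us vs)
      have "length (us @ vs) = length ss"
        using Node.prems(6) strip_here[of us vs m b] strip_below[OF s, where a = a] here unfolding t
        by (auto dest!: arg_cong[where f = length])
      then show ?thesis using len here by simp
    next
      case below
      have *: "map (strip m) ss = map (strip m) ts"
        using Node.prems(6) strip_below[OF s] strip_below[OF below] unfolding t by simp
      have "ss ! i = ts ! i" if "i < length ss" for i
      proof (rule Node.IH)
        show "strip m (ss ! i) = strip m (ts ! i)" using * that len by (metis nth_map)
        show "underlying (ss ! i) = underlying (ts ! i)"
          using Node.prems(5) that len unfolding t by (simp add: list_eq_iff_nth_eq)
      qed (use that len s below Node.prems(3,4) in \<open>auto simp: t\<close>)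
      then show ?thesis using len ab t by (simp add: list_eq_iff_nth_eq)
    qed
  qed
qed

text \<open>
  The deletion taking \<open>T\<close> to the shape of \<open>t'\<close> names a place for the new leaf. The label \<open>m\<close> is put
  not there but behind the leaves that follow; this yields the same shape, because a leaf followed by
  leaves looks like leaves followed by a leaf.
\<close>

lemma insert_max_label:
  assumes "delete_leaf T (underlying t')" "increasing t'" "\<forall>x\<in>set (labels t'). x < m"
  shows "\<exists>t. underlying t = T \<and> strip m t = t' \<and> increasing t \<and> ends_leaf_run m t \<and>
     mset (labels t) = add_mset m (mset (labels t'))"
  using assms
proof (induction T "underlying t'" arbitrary: t' rule: delete_leaf.induct)
  case (here a xs b ys)
  obtain k ts where t': "t' = Node k ts" by (cases t')
  with here have "map underlying ts = xs @ ys" by simp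
  then obtain us vs where ts: "ts = us @ vs" "map underlying us = xs" "map underlying vs = ys"
    by (auto simp: map_eq_append_conv)
  let ?leaf = "\<lambda>s. children s = []"
  define ls rs where "ls = takeWhile ?leaf vs" and "rs = dropWhile ?leaf vs"
  let ?t = "Node k (us @ ls @ Node m [] # rs)"
  have vs: "vs = ls @ rs" by (simp add: ls_def rs_def)
  have "map underlying ls = replicate (length ls) (Node () [])"
    by (rule replicate_eqI) (auto simp: ls_def children_empty_iff_underlying dest!: set_takeWhileD)
  then have "underlying ?t = Node a (xs @ Node b [] # ys)"
    using ts vs replicate_app_Cons_same[of "length ls" "Node () []" "map underlying rs"] by simp
  moreover have notin: "m \<notin> set (labels s)" if "s \<in> set (us @ ls) \<union> set rs" for s
    using here(3) that unfolding t' ts vs by auto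
  moreover have "strip m ?t = t'"
    using strip_here[of "us @ ls" rs m k] notin by (simp add: t' ts vs)
  moreover have "ends_leaf_run m ?t"
  proof -
    have "rs \<noteq> [] \<longrightarrow> children (hd rs) \<noteq> []"
      using hd_dropWhile[of ?leaf vs] unfolding rs_def by blast
    then have "ends_leaf_run m (Node k ((us @ ls) @ Node m [] # rs))"
      using ends_leaf_run_here notin by blast
    then show ?thesis by (simp only: append_assoc)
  qed
  moreover have "increasing ?t" using here(2,3) by (auto simp: t' ts vs)
  moreover have "mset (labels ?t) = add_mset m (mset (labels t'))" by (simp add: t' ts vs)
  ultimately show ?case by blast
next
  case (below T1 T2 a xs ys)
  obtain k ts where t': "t' = Node k ts" by (cases t')
  with below have "map underlying ts = xs @ T2 # ys" by simp
  then obtain us s' vs where ts: "ts = us @ s' # vs" "map underlying us = xs"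
      "underlying s' = T2" "map underlying vs = ys"
    by (auto simp: map_eq_append_conv map_eq_Cons_conv)
  have "increasing s'" "\<forall>x\<in>set (labels s'). x < m" using below.prems by (auto simp: t' ts)
  then obtain s where s: "underlying s = T1" "strip m s = s'" "increasing s" "ends_leaf_run m s"
      "mset (labels s) = add_mset m (mset (labels s'))"
    using below.hyps(2) ts by blast
  let ?t = "Node k (us @ s # vs)"
  have roots: "root s = root s'" using s(2) by auto
  have notin: "m \<notin> set (labels r)" if "r \<in> set us \<union> set vs \<union> {s'}" for r
    using below.prems(2) that unfolding t' ts by auto
  then have ne: "root r \<noteq> m" if "r \<in> set us \<union> set vs \<union> {s}" for r
    using that roots root_in_labels by (metis Un_iff singletonD singletonI)
  have "underlying ?t = Node a (xs @ T1 # ys)" using ts s by simp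
  moreover have "strip m ?t = t'"
  proof -
    have "filter (\<lambda>t. root t \<noteq> m) (us @ s # vs) = us @ s # vs"
      using ne by (intro filter_True) auto
    moreover have "map (strip m) us = us" "map (strip m) vs = vs"
      using notin by (auto intro!: map_idI strip_id)
    ultimately show ?thesis using s(2) by (simp add: t' ts del: filter_append)
  qed
  moreover have "increasing ?t" using below.prems(1) s(3) roots by (auto simp: t' ts)
  moreover have "ends_leaf_run m ?t"
  proof -
    have "ends_leaf_run m r" if "r \<in> set us \<union> set vs \<union> {s}" for r
      using that notin s(4) ends_leaf_run_trivial by blast
    moreover have "root x \<noteq> m" if "us @ s # vs = as @ x # bs" for as x bs
    proof -
      have "x \<in> set (us @ s # vs)" unfolding that by simp
      then show ?thesis using ne by auto
    qed
    ultimately show ?thesis by auto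
  qed
  moreover have "mset (labels ?t) = add_mset m (mset (labels t'))" using s(5) by (simp add: t' ts)
  ultimately show ?case by blast
qed


section \<open>The common recursion\<close>

lemma topped_increasing_otree:
  assumes "increasing_otree t" "edges t \<ge> 1"
  shows "topped (edges t) t" "edges t \<in> set (labels t)"
proof -
  have "root t \<noteq> edges t"
  proof
    assume r: "root t = edges t"
    obtain a c cs where t: "t = Node a (c # cs)"
      using assms(2) by (cases t; cases "children t") auto
    then have "root c \<in> set (labels t)" by simp
    then have "root c \<le> edges t" using assms(1) unfolding increasing_otree_def by auto
    moreover have "root t < root c" using assms(1) t unfolding increasing_otree_def by simp
    ultimately show False using r by simp
  qed
  then show "topped (edges t) t" "edges t \<in> set (labels t)"
    using assms unfolding topped_def increasing_otree_def by auto
qed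

lemma bij_betw_strip_klazar:
  assumes "edges T = n" "n \<ge> 1"
  shows "bij_betw (strip n) {K. klazar_tree K \<and> underlying K = T}
           {K'. klazar_tree K' \<and> delete_leaf T (underlying K')}"
proof -
  let ?A = "{K. klazar_tree K \<and> underlying K = T}"
  let ?B = "{K'. klazar_tree K' \<and> delete_leaf T (underlying K')}"
  have top: "topped n K" "n \<in> set (labels K)" "no_violator K" "increasing_otree K" if "K \<in> ?A" for K
    using that assms topped_increasing_otree[of K] edges_underlying[of K]
    by (auto simp: klazar_tree_iff)
  have into: "strip n K \<in> ?B" if K: "K \<in> ?A" for K
  proof -
    have del: "delete_leaf K (strip n K)" using delete_leaf_strip top[OF K] by blast
    have "edges K = n" using K assms edges_underlying[of K] by auto
    then have "edges (strip n K) = n - 1" using edges_delete_leaf[OF del] by simp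
    moreover have "{0..n} - {n} = {0..n - 1}" using assms(2) by auto
    ultimately have "increasing_otree (strip n K)"
      using top[OF K] \<open>edges K = n\<close> labels_strip[OF top(1)[OF K]] increasing_strip
      unfolding increasing_otree_def by auto
    moreover have "delete_leaf T (underlying (strip n K))"
      using delete_leaf_map[OF del] K unfolding underlying_def by auto
    moreover have "no_violator (strip n K)"
      using no_violator_strip_iff top[OF K] by blast
    ultimately show ?thesis by (simp add: klazar_tree_iff)
  qed
  have inj: "inj_on (strip n) ?A"
  proof (rule inj_onI)
    fix K1 K2 assume K: "K1 \<in> ?A" "K2 \<in> ?A" and eq: "strip n K1 = strip n K2"
    have "ends_leaf_run n K" if "K \<in> ?A" for K
      using no_violator_strip_iff top[OF that] by blast
    then show "K1 = K2" using strip_inj[of n K1 K2] top(1) K eq by auto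
  qed
  have onto: "K' \<in> strip n ` ?A" if K': "K' \<in> ?B" for K'
  proof -
    have eK': "n = Suc (edges K')"
      using K' assms edges_delete_leaf[of T "underlying K'"] by simp
    have inc: "increasing_otree K'" "no_violator K'"
      using K' by (auto simp: klazar_tree_iff)
    have "\<forall>x\<in>set (labels K'). x < n" using inc eK' by (auto simp: increasing_otree_def)
    then obtain K where K: "underlying K = T" "strip n K = K'" "increasing K" "ends_leaf_run n K"
        "mset (labels K) = add_mset n (mset (labels K'))"
      using insert_max_label[of T K' n] K' inc by (auto simp: increasing_otree_def)
    have eK: "edges K = n" using K(1) assms edges_underlying[of K] by simp
    have "mset (labels K) = mset (n # labels K')" using K(5) by simp
    then have "distinct (labels K) \<longleftrightarrow> distinct (n # labels K')"
        and "set (labels K) = set (n # labels K')"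
      by (rule mset_eq_imp_distinct_iff, rule mset_eq_setD)
    then have inc': "increasing_otree K"
      using inc K(3) eK eK' unfolding increasing_otree_def by auto
    then have "no_violator K"
      using no_violator_strip_iff[of n K] topped_increasing_otree[of K] eK assms K inc by simp
    then have "K \<in> ?A" using inc' K by (simp add: klazar_tree_iff)
    then show ?thesis using K(2) by blast
  qed
  show ?thesis
  proof (rule bij_betw_imageI[OF inj])
    show "strip n ` ?A = ?B" by (intro equalityI image_subsetI subsetI into onto)
  qed
qed

lemma card_klazar_rec:
  assumes "edges T \<ge> 1"
  shows "card {K. klazar_tree K \<and> underlying K = T} =
     (\<Sum>T' | delete_leaf T T'. card {K. klazar_tree K \<and> underlying K = T'})"
proof -
  have "card {K. klazar_tree K \<and> underlying K = T} =
      card {K'. klazar_tree K' \<and> delete_leaf T (underlying K')}"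
    by (rule bij_betw_same_card[OF bij_betw_strip_klazar]) (use assms in auto)
  also have "{K'. klazar_tree K' \<and> delete_leaf T (underlying K')} =
      (\<Union>T'\<in>{T'. delete_leaf T T'}. {K. klazar_tree K \<and> underlying K = T'})" by auto
  also have "card \<dots> = (\<Sum>T' | delete_leaf T T'. card {K. klazar_tree K \<and> underlying K = T'})"
    by (intro card_UN_disjoint ballI impI finite_delete_leaf finite_klazar_trees_underlying) auto
  finally show ?thesis .
qed

lemma drawings_rec:
  assumes "edges T \<ge> 2"
  shows "drawings T = (\<lambda>ts. ts @ [T]) ` (\<Union>T'\<in>{T'. delete_leaf T T'}. drawings T')"
    (is "_ = ?R")
proof (intro equalityI subsetI)
  fix ts assume ts: "ts \<in> drawings T"
  have "ts \<noteq> []" "last ts = T" using ts by (auto simp: drawings_def)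
  then obtain us where us: "ts = us @ [T]" by (cases ts rule: rev_cases) auto
  have len: "length us = edges T - 1" using ts us by (auto simp: drawings_def)
  have ne: "us \<noteq> []" using len assms by auto
  have del: "delete_leaf (ts ! (i - 1)) (ts ! (i - 2))" if "i \<in> {2..edges T}" for i
    using ts that by (auto simp: drawings_def)
  have "ts ! (edges T - 1) = T" using us len by (simp add: nth_append)
  moreover have "ts ! (edges T - 2) = last us"
  proof -
    have "edges T - 2 < length us" "edges T - 2 = length us - 1" using len assms by auto
    then show ?thesis using us ne by (simp add: nth_append last_conv_nth)
  qed
  ultimately have d: "delete_leaf T (last us)" using del[of "edges T"] assms by simp
  then have e: "edges T = Suc (edges (last us))" by (rule edges_delete_leaf)
  have "edges (us ! (i - 1)) = i" if "i \<in> {1..edges (last us)}" for i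
  proof -
    have "edges (ts ! (i - 1)) = i" using ts that e by (auto simp: drawings_def)
    then show ?thesis using that us len e by (auto simp: nth_append split: if_splits)
  qed
  moreover have "delete_leaf (us ! (i - 1)) (us ! (i - 2))" if "i \<in> {2..edges (last us)}" for i
    using del[of i] that us len e by (auto simp: nth_append split: if_splits)
  ultimately have "us \<in> drawings (last us)" using ne len e by (auto simp: drawings_def)
  then show "ts \<in> ?R" using d us by auto
next
  fix ts assume "ts \<in> ?R"
  then obtain us T' where us: "ts = us @ [T]" "delete_leaf T T'" "us \<in> drawings T'" by auto
  have e: "edges T = Suc (edges T')" using us(2) by (rule edges_delete_leaf)
  have len: "length us = edges T'" and ne: "us \<noteq> []" and last: "last us = T'"
    using us(3) by (auto simp: drawings_def)
  have "edges (ts ! (i - 1)) = i" if "i \<in> {1..edges T}" for i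
  proof (cases "i = edges T")
    case True
    then show ?thesis using us(1) len e by (simp add: nth_append)
  next
    case False
    then have "i \<in> {1..edges T'}" using that e by simp
    then have "edges (us ! (i - 1)) = i" using us(3) by (auto simp: drawings_def)
    then show ?thesis using us(1) len \<open>i \<in> {1..edges T'}\<close> by (auto simp: nth_append)
  qed
  moreover have "delete_leaf (ts ! (i - 1)) (ts ! (i - 2))" if "i \<in> {2..edges T}" for i
  proof (cases "i = edges T")
    case True
    then have "ts ! (i - 1) = T" "ts ! (i - 2) = T'"
      using us(1) len e ne last assms by (auto simp: nth_append last_conv_nth numeral_2_eq_2)
    then show ?thesis using us(2) by simp
  next
    case False
    then have "i \<in> {2..edges T'}" using that e by simp
    then have "delete_leaf (us ! (i - 1)) (us ! (i - 2))" using us(3) by (auto simp: drawings_def)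
    then show ?thesis using us(1) len \<open>i \<in> {2..edges T'}\<close> by (auto simp: nth_append)
  qed
  ultimately show "ts \<in> drawings T" using us(1) len e by (auto simp: drawings_def)
qed

lemma w12_rec:
  assumes "edges T \<ge> 2"
  shows "w12 T = (\<Sum>T' | delete_leaf T T'. w12 T')"
proof -
  have "w12 T = card (\<Union>T'\<in>{T'. delete_leaf T T'}. drawings T')"
    unfolding w12_def drawings_rec[OF assms] by (rule card_image) (simp add: inj_on_def)
  also have "\<dots> = (\<Sum>T' | delete_leaf T T'. card (drawings T'))"
  proof (intro card_UN_disjoint ballI impI finite_delete_leaf finite_drawings)
    show "drawings T1 \<inter> drawings T2 = {}" if "T1 \<noteq> T2" for T1 T2
      using that unfolding drawings_def by blast
  qed
  finally show ?thesis unfolding w12_def .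
qed

text \<open>
  The recursion for drawings starts at one edge, because a drawing is nonempty and the tree without
  edges has none. On the Klazar side the recursion can go down one step further, to the single
  vertex.
\<close>

lemma w12_one_edge:
  assumes "edges T = 1"
  shows "w12 T = 1"
proof -
  have "drawings T = {[T]}" using assms by (auto simp: drawings_def length_Suc_conv)
  then show ?thesis by (simp add: w12_def)
qed

lemma edges_0_iff: "edges t = 0 \<longleftrightarrow> (\<exists>a. t = Node a [])"
  by (cases t; cases "children t") auto

lemma card_klazar_one_edge:
  assumes "edges T = 1"
  shows "card {K. klazar_tree K \<and> underlying K = T} = 1"
proof -
  have T: "T = Node () [Node () []]"
  proof -
    obtain cs where "T = Node () cs" by (cases T) auto
    moreover obtain c ds where "cs = c # ds" using assms calculation by (cases cs) auto
    moreover have "ds = []" using assms calculation by (cases ds) auto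
    ultimately show ?thesis using assms by (auto simp: edges_0_iff)
  qed
  have "{T'. delete_leaf T T'} = {Node () []}"
    using edges_delete_leaf[of T] assms delete_leaf.here[of "()" "[]" "()" "[]"]
    by (auto simp: T edges_0_iff)
  moreover have "{K. klazar_tree K \<and> underlying K = Node () []} = {Node 0 []}"
  proof -
    have "K = Node 0 []" if "klazar_tree K" "underlying K = Node () []" for K
      using that by (cases K) (auto simp: klazar_tree_iff increasing_otree_def)
    moreover have "klazar_tree (Node 0 [])"
      by (simp add: klazar_tree_iff increasing_otree_def)
    moreover have "underlying (Node 0 []) = Node () []" by simp
    ultimately show ?thesis by blast
  qed
  ultimately show ?thesis using card_klazar_rec[of T] assms by simp
qed

lemma w12_eq_card_klazar:
  "edges T = Suc n \<Longrightarrow> w12 T = card {K. klazar_tree K \<and> underlying K = T}"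
proof (induction n arbitrary: T)
  case 0
  then show ?case by (simp add: w12_one_edge card_klazar_one_edge)
next
  case (Suc n)
  have "w12 T = (\<Sum>T' | delete_leaf T T'. w12 T')" using Suc.prems by (intro w12_rec) simp
  also have "\<dots> = (\<Sum>T' | delete_leaf T T'. card {K. klazar_tree K \<and> underlying K = T'})"
    using Suc.prems by (intro sum.cong refl Suc.IH) (auto dest: edges_delete_leaf)
  also have "\<dots> = card {K. klazar_tree K \<and> underlying K = T}"
    using Suc.prems by (intro card_klazar_rec[symmetric]) simp
  finally show ?case .
qed

theorem mainTheorem7:
  shows "(\<forall>n\<ge>1. \<forall>T :: unit otree. edges T = n \<longrightarrow>
            w12 T = card {K. klazar_tree K \<and> underlying K = T}) \<and>
         (\<forall>n\<ge>1. w12_total n = card {K. klazar_tree K \<and> edges K = n})"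
proof (intro conjI allI impI)
  show *: "w12 T = card {K. klazar_tree K \<and> underlying K = T}" if "1 \<le> n" "edges T = n" for n T
    using that w12_eq_card_klazar[of T "n - 1"] by simp
  show "w12_total n = card {K. klazar_tree K \<and> edges K = n}" if "1 \<le> n" for n
  proof -
    have "{K. klazar_tree K \<and> edges K = n} =
        (\<Union>T\<in>{T. edges T = n}. {K. klazar_tree K \<and> underlying K = T})" by auto
    also have "card \<dots> = (\<Sum>T | edges T = n. card {K. klazar_tree K \<and> underlying K = T})"
      by (rule card_UN_disjoint) (auto simp: finite_unlabeled_otrees finite_klazar_trees_underlying)
    also have "\<dots> = w12_total n" unfolding w12_total_def using * that by (intro sum.cong) auto
    finally show ?thesis by simp
  qed
qed

end
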